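(* Let $p$ be an odd prime and $r>0$. If $k$ is an integer such that $p^r-k$ is not divisible by $p-1$, then $v_p(c(p^r,k))\ge r$. If on the other hand $p^r-k=\ell(p-1)$, then $$v_p(c(p^r,k))=r-1-v_p(\ell).$$
   Context: For a nonzero integer $m$ and a prime $p$, $v_p(m)$ denotes the exponent of the highest power of $p$ dividing $m$, and $v_p(0)=+\infty$. The numbers $c(n,k)$ are the signless Stirling numbers of the first kind, defined by the polynomial identity $\prod_{j=0}^{n-1}(1+jt)=\sum_{k=0}^{n}c(n,k)\,t^{n-k}$ in $\mathbb{Z}[t]$, with $c(n,k)=0$ for $k<0$ or $k>n$.
   Formalization: The second claim is stated only for 1 ≤ ℓ ≤ p^(r-1); the formula fails for every other ℓ (for example p=3, r=2, k=1, ℓ=4: v_3(c(9,1)) = 2, but r-1-v_3(ℓ) = 1; for ℓ=0 the left side is 0 and the right side is -∞). *)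

theory Defs
  imports
    "HOL-Combinatorics.Stirling"
    "HOL-Computational_Algebra.Computational_Algebra"
    "HOL-Library.Extended_Real"
begin

text \<open>
  The values are extended reals, so that \<open>v\<^sub>p(0) = \<infinity>\<close> and differences of valuations are
  not truncated.
\<close>

definition vp :: "nat \<Rightarrow> int \<Rightarrow> ereal" where
  "vp p m = (if m = 0 then \<infinity> else ereal (real (multiplicity (int p) m)))"

text \<open>
  The library function \<open>stirling\<close> gives the signless Stirling numbers of the first kind; only
  an integer lower index has to be accommodated. The three lemmas below are the defining
  properties of these numbers.
\<close>

definition stirling1 :: "nat \<Rightarrow> int \<Rightarrow> int" where
  "stirling1 n k = (if k < 0 then 0 else int (stirling n (nat k)))"

lemma stirling1_neg: "k < 0 \<Longrightarrow> stirling1 n k = 0"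
  by (simp add: stirling1_def)

lemma stirling1_gt: "k > int n \<Longrightarrow> stirling1 n k = 0"
  by (simp add: stirling1_def)

lemma stirling1_generating_polynomial:
  "(\<Prod>j<n. [:1, int j:]) = (\<Sum>k\<le>n. monom (stirling1 n (int k)) (n - k))"
proof (induction n)
  case 0
  then show ?case by (simp add: stirling1_def monom_0)
next
  case (Suc n)
  have lin: "[:1, int n:] = monom 1 0 + monom (int n) 1"
    by (simp add: monom_0 monom_altdef)
  have shift: "(\<Sum>k\<le>Suc n. monom (int (n * stirling n k)) (Suc n - k))
             = (\<Sum>k\<le>n. monom (int (n * stirling n k)) (Suc (n - k)))"
    by (auto intro!: sum.cong simp: Suc_diff_le)
  have zero: "int (n * stirling n 0) = 0"
    by (cases n) auto
  have "(\<Sum>k\<le>Suc n. monom (stirling1 (Suc n) (int k)) (Suc n - k))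
      = (\<Sum>k\<le>n. monom (int (n * stirling n (Suc k) + stirling n k)) (n - k))"
    by (subst sum.atMost_Suc_shift) (simp add: stirling1_def nat_add_distrib)
  also have "\<dots> = (\<Sum>k\<le>n. monom (int (n * stirling n (Suc k))) (n - k))
                 + (\<Sum>k\<le>n. monom (int (stirling n k)) (n - k))"
    by (simp add: add_monom [symmetric] sum.distrib)
  also have "(\<Sum>k\<le>n. monom (int (n * stirling n (Suc k))) (n - k))
           = (\<Sum>k\<le>Suc n. monom (int (n * stirling n k)) (Suc n - k))"
    using zero by (subst sum.atMost_Suc_shift) (simp only: monom_0 diff_Suc_Suc diff_zero monom_eq_0 add_0_left)
  also note shift
  also have "(\<Sum>k\<le>n. monom (int (n * stirling n k)) (Suc (n - k)))
           + (\<Sum>k\<le>n. monom (int (stirling n k)) (n - k))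
           = (\<Sum>k\<le>n. monom (stirling1 n (int k)) (n - k)) * [:1, int n:]"
    unfolding lin
    by (simp add: stirling1_def algebra_simps sum_distrib_left mult_monom sum.distrib)
  also have "\<dots> = (\<Prod>j<Suc n. [:1, int j:])"
    using Suc.IH by simp
  finally show ?case by simp
qed

end

theory Submission
  imports "HOL-Number_Theory.Residues" Defs
begin

text \<open>
  Reverse the rising factorial to \<open>P\<^sub>r(t) = \<Prod>\<^bsub>j < p^r\<^esub> (1 + j t)\<close>, whose coefficient of \<open>t\<^sup>m\<close> is
  \<open>c(p\<^sup>r, p\<^sup>r - m)\<close>. Everything follows from the single congruence
  \<open>P\<^sub>r(t) \<equiv> (1 - t\<^bsup>p-1\<^esup>)\<^bsup>p^(r-1)\<^esup>\<close> modulo \<open>p\<^sup>r\<close>: the right-hand side has no coefficients at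
  exponents not divisible by \<open>p - 1\<close>, and for \<open>1 \<le> \<ell> \<le> p\<^bsup>r-1\<^esup>\<close> its coefficient at exponent
  \<open>\<ell> (p - 1)\<close> is, up to sign, \<open>p\<^bsup>r-1\<^esup> choose \<ell>\<close>. The latter has valuation \<open>r - 1 - v\<^sub>p(\<ell>)\<close>, which is below \<open>r\<close> and
  hence is not disturbed by a multiple of \<open>p\<^sup>r\<close>.

  The congruence is proved by induction on \<open>r\<close>. For \<open>r = 1\<close> both sides have degree below \<open>p\<close>
  and, by Fermat's little theorem, the same values modulo \<open>p\<close> at all residues, so they agree
  (\<open>rising_prod_prime\<close>). For the step, split the indices below \<open>p\<^bsup>r+1\<^esup>\<close> into the \<open>p\<close> blocks
  \<open>i p\<^sup>r + j\<close>. To first order in \<open>q = p\<^sup>r\<close>, the \<open>i\<close>-th block is \<open>P\<^sub>r + q i S\<close> with \<open>S\<close>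
  independent of \<open>i\<close>, so the product of the blocks is \<open>P\<^sub>r\<^sup>p + q S P\<^sub>r\<^bsup>p-1\<^esup> \<Sum>i\<close> modulo \<open>q\<^sup>2\<close>.
  Since \<open>p\<close> is odd, it divides \<open>\<Sum>i = p (p - 1) / 2\<close>, and the linear term vanishes modulo
  \<open>p q\<close> (\<open>rising_prod_blocks\<close>). Finally, raising to the \<open>p\<close>-th power improves a
  congruence modulo \<open>p\<^sup>r\<close> to one modulo \<open>p\<^bsup>r+1\<^esup>\<close> (\<open>mult_dvd_power_diff\<close>).
\<close>

section \<open>Congruences in commutative rings\<close>

text \<open>
  In \<open>x\<^sup>n - y\<^sup>n = (x - y) (\<Sum>i<n. y\<^bsup>n-1-i\<^esup> x\<^sup>i)\<close> all \<open>n\<close> summands are congruent to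
  \<open>y\<^bsup>n-1\<^esup>\<close> modulo \<open>n\<close>, so the second factor contributes another divisor \<open>n\<close>.
\<close>

lemma mult_dvd_power_diff:
  fixes x y q :: "'a::comm_ring_1"
  assumes "q dvd x - y" and "of_nat n dvd q"
  shows "of_nat n * q dvd x ^ n - y ^ n"
proof -
  have nxy: "of_nat n dvd x - y"
    using assms dvd_trans by blast
  have summand: "of_nat n dvd y ^ (n - Suc i) * x ^ i - y ^ (n - 1)" if "i < n" for i
  proof -
    have "y ^ (n - 1) = y ^ (n - Suc i) * y ^ i"
      using that by (simp flip: power_add)
    then have "y ^ (n - Suc i) * x ^ i - y ^ (n - 1) = y ^ (n - Suc i) * (x ^ i - y ^ i)"
      by (simp add: right_diff_distrib)
    also have "\<dots> = (x - y) * (y ^ (n - Suc i) * (\<Sum>j<i. y ^ (i - Suc j) * x ^ j))"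
      by (subst power_diff_sumr2) (simp add: mult_ac)
    finally show ?thesis
      using nxy by simp
  qed
  have "of_nat n dvd (\<Sum>i<n. y ^ (n - Suc i) * x ^ i - y ^ (n - 1)) + of_nat n * y ^ (n - 1)"
    using summand by (intro dvd_add dvd_sum) (simp_all only: lessThan_iff dvd_triv_left)
  then have "of_nat n dvd (\<Sum>i<n. y ^ (n - Suc i) * x ^ i)"
    by (simp add: sum_subtractf)
  then have "q * of_nat n dvd (x - y) * (\<Sum>i<n. y ^ (n - Suc i) * x ^ i)"
    using assms(1) by (intro mult_dvd_mono)
  then show ?thesis
    by (simp add: power_diff_sumr2 mult.commute)
qed

text \<open>
  The expansion of a product to first order in \<open>q\<close>. It is used at two levels: for the factors
  inside one block of indices, and then for the product of the blocks themselves.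
\<close>

lemma prod_first_order:
  fixes a b :: "'i \<Rightarrow> 'a::comm_ring_1"
  assumes "finite A"
  shows "\<exists>z. (\<Prod>j\<in>A. a j + q * b j) =
    (\<Prod>j\<in>A. a j) + q * (\<Sum>j\<in>A. b j * (\<Prod>i\<in>A - {j}. a i)) + q\<^sup>2 * z"
  using assms
proof (induction A)
  case empty
  show ?case
    by (intro exI[of _ 0]) simp
next
  case (insert k A)
  define D where "D = (\<Sum>j\<in>A. b j * (\<Prod>i\<in>A - {j}. a i))"
  obtain z where z: "(\<Prod>j\<in>A. a j + q * b j) = (\<Prod>j\<in>A. a j) + q * D + q\<^sup>2 * z"
    using insert.IH D_def by blast
  have "(\<Sum>j\<in>A. b j * (\<Prod>i\<in>insert k A - {j}. a i)) = (\<Sum>j\<in>A. a k * (b j * (\<Prod>i\<in>A - {j}. a i)))"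
  proof (rule sum.cong)
    fix j assume "j \<in> A"
    then have "insert k A - {j} = insert k (A - {j})"
      using insert.hyps by auto
    then show "b j * (\<Prod>i\<in>insert k A - {j}. a i) = a k * (b j * (\<Prod>i\<in>A - {j}. a i))"
      using insert.hyps by (simp add: mult_ac)
  qed simp
  then have D': "(\<Sum>j\<in>insert k A. b j * (\<Prod>i\<in>insert k A - {j}. a i)) =
      b k * (\<Prod>j\<in>A. a j) + a k * D"
    using insert.hyps by (simp add: D_def sum_distrib_left)
  have "(\<Prod>j\<in>insert k A. a j + q * b j) =
      (\<Prod>j\<in>insert k A. a j) + q * (b k * (\<Prod>j\<in>A. a j) + a k * D)
      + q\<^sup>2 * (b k * D + a k * z + q * b k * z)"
    using insert.hyps by (simp add: z algebra_simps power2_eq_square)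
  then show ?case
    unfolding D' by blast
qed

section \<open>The generating polynomial modulo powers of the prime\<close>

definition rising_prod :: "nat \<Rightarrow> int poly" where
  "rising_prod n = (\<Prod>j<n. [:1, int j:])"

lemma coeff_rising_prod:
  assumes "m \<le> n"
  shows "coeff (rising_prod n) m = stirling1 n (int n - int m)"
proof -
  have "coeff (rising_prod n) m = (\<Sum>k\<le>n. if k = n - m then stirling1 n (int k) else 0)"
    unfolding rising_prod_def stirling1_generating_polynomial coeff_sum coeff_monom
    using assms by (intro sum.cong) (auto simp: diff_diff_cancel)
  also have "\<dots> = stirling1 n (int (n - m))"
    by (subst sum.delta) auto
  finally show ?thesis
    using assms by (simp only: of_nat_diff)
qed

text \<open>
  A nonzero polynomial over the field of \<open>p\<close> elements has at most as many roots as its degree.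
  Splitting off one root at a time by synthetic division proves this directly for integer
  polynomials; the bound \<open>n \<le> p\<close> makes the \<open>n\<close> roots distinct modulo \<open>p\<close>.
\<close>

lemma const_prime_dvd_of_roots:
  fixes f :: "int poly" and p :: nat
  assumes "prime p" and "n \<le> p" and "f = 0 \<or> degree f < n"
    and "\<And>i. i < n \<Longrightarrow> int p dvd poly f (int i)"
  shows "[:int p:] dvd f"
  using assms(2-)
proof (induction n arbitrary: f)
  case 0
  then show ?case by simp
next
  case (Suc n)
  define g where "g = synthetic_div f (int n)"
  have f: "f = [:- int n, 1:] * g + [:poly f (int n):]"
    unfolding g_def by (simp only: synthetic_div_correct')
  have "[:int p:] dvd g"
  proof (rule Suc.IH)
    show "n \<le> p" using Suc.prems by simp
    show "g = 0 \<or> degree g < n"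
      using Suc.prems(2) by (auto simp: g_def degree_synthetic_div synthetic_div_eq_0_iff)
    fix i assume i: "i < n"
    have "poly f (int i) = (int i - int n) * poly g (int i) + poly f (int n)"
      by (subst f) (simp add: algebra_simps)
    then have "(int i - int n) * poly g (int i) = poly f (int i) - poly f (int n)"
      by simp
    moreover have "int p dvd poly f (int i) - poly f (int n)"
      using Suc.prems(3)[of i] Suc.prems(3)[of n] i by simp
    ultimately have "int p dvd (int i - int n) * poly g (int i)"
      by simp
    moreover have "\<not> int p dvd int i - int n"
      using i Suc.prems(1) zdvd_not_zless[of "int n - int i" "int p"]
      by (simp add: dvd_diff_commute)
    ultimately show "int p dvd poly g (int i)"
      using assms(1) by (simp add: prime_dvd_mult_iff)
  qed
  moreover have "[:int p:] dvd [:poly f (int n):]"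
    using Suc.prems(3)[of n] by simp
  ultimately show ?case
    by (subst f) (intro dvd_add dvd_mult)
qed

text \<open>
  The two polynomials have degree below \<open>p\<close>, so it suffices to compare values modulo \<open>p\<close>.
  At \<open>t = 0\<close> both are \<open>1\<close>. At a unit \<open>t\<close> the product vanishes, because some index \<open>j\<close> is
  congruent to \<open>-1/t\<close>, and \<open>1 - t\<^bsup>p-1\<^esup>\<close> vanishes by Fermat.
\<close>

lemma rising_prod_prime:
  assumes "prime p"
  shows "[:int p:] dvd rising_prod p - (1 - monom 1 (p - 1))"
proof (rule const_prime_dvd_of_roots[where n = p])
  have p: "p > 1" using assms by (rule prime_gt_1_nat)
  have "degree (rising_prod p) \<le> p - 1"
  proof (rule degree_le, intro allI impI)
    fix m assume "p - 1 < m"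
    have "coeff (rising_prod p) p = 0"
      using p by (simp add: coeff_rising_prod stirling1_def)
    moreover have "coeff (rising_prod p) m = 0" if "m > p"
      unfolding rising_prod_def stirling1_generating_polynomial
      using that by (auto simp: coeff_sum intro!: sum.neutral)
    ultimately show "coeff (rising_prod p) m = 0"
      using \<open>p - 1 < m\<close> by (cases "m = p") auto
  qed
  then have "degree (rising_prod p - (1 - monom 1 (p - 1))) \<le> p - 1"
    by (intro degree_diff_le) (auto simp: degree_monom_le)
  then show "rising_prod p - (1 - monom 1 (p - 1)) = 0 \<or>
      degree (rising_prod p - (1 - monom 1 (p - 1))) < p"
    using p by linarith
next
  fix i assume i: "i < p"
  have p: "p > 1" using assms by (rule prime_gt_1_nat)
  have val: "poly (rising_prod p) (int i) = (\<Prod>j<p. 1 + int i * int j)"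
    by (simp add: rising_prod_def poly_prod)
  show "int p dvd poly (rising_prod p - (1 - monom 1 (p - 1))) (int i)"
  proof (cases "i = 0")
    case True
    then show ?thesis using p val by (simp add: poly_monom zero_power)
  next
    case False
    then have ndvd: "\<not> p dvd i"
      using i by (auto dest: dvd_imp_le)
    then have "coprime (int i) (int p)"
      using prime_imp_coprime[OF assms] by (simp add: coprime_commute)
    then obtain x where x: "[int i * x = 1] (mod int p)"
      using cong_solve_coprime_int by blast
    define j where "j = nat ((- x) mod int p)"
    have j: "j < p" "int j = (- x) mod int p"
      using p by (simp_all add: j_def nat_less_iff)
    have "[1 + int i * int j = 1 + int i * (- x)] (mod int p)"
      unfolding j(2) by (intro cong_add cong_mult) (simp_all add: cong_def)
    also have "[1 + int i * (- x) = 1 + - 1] (mod int p)"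
      using x by (intro cong_add) (simp_all add: cong_minus_minus_iff)
    finally have "int p dvd 1 + int i * int j"
      by (simp add: cong_0_iff)
    then have "int p dvd poly (rising_prod p) (int i)"
      unfolding val using j(1) by (meson dvd_prodI dvd_trans finite_lessThan lessThan_iff)
    moreover have "[int (i ^ (p - 1)) = int 1] (mod int p)"
      using fermat_theorem[OF assms ndvd] by (simp only: cong_int_iff)
    then have "int p dvd int i ^ (p - 1) - 1"
      by (simp add: cong_iff_dvd_diff)
    ultimately show ?thesis
      by (simp add: poly_monom dvd_diff_commute flip: diff_add_eq diff_diff_eq2)
  qed
qed (use assms in auto)

lemma odd_dvd_sum_lessThan:
  fixes n :: nat
  assumes "odd n"
  shows "n dvd (\<Sum>i<n. i)"
proof -
  obtain m where m: "n = 2 * m + 1"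
    using assms by (elim oddE)
  have "(\<Sum>i<n. i) = n * m"
    using Sum_Ico_nat[of 0 n] by (simp add: m lessThan_atLeast0)
  then show ?thesis by simp
qed

text \<open>
  Cut the indices below \<open>n q\<close> into \<open>n\<close> blocks of length \<open>q\<close>. A block agrees with the first one
  modulo \<open>q\<close> only, but to first order its deviation is proportional to the block number. In the
  product the deviations add up to a multiple of \<open>q (0 + \<dots> + (n - 1))\<close>, which for odd \<open>n\<close> is
  a multiple of \<open>n q\<close>; the second-order terms are multiples of \<open>q\<^sup>2\<close>, where \<open>n\<close> divides \<open>q\<close>.
\<close>

lemma rising_prod_blocks:
  assumes "odd n" and "n dvd q"
  shows "[:int (n * q):] dvd rising_prod (n * q) - rising_prod q ^ n"
proof -
  define Q :: "int poly" where "Q = of_nat q"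
  define P where "P = rising_prod q"
  define t :: "int poly" where "t = [:0, 1:]"
  define S where "S = (\<Sum>j<q. t * (\<Prod>l\<in>{..<q} - {j}. [:1, int l:]))"
  have nQ: "of_nat n dvd Q"
    using assms(2) unfolding Q_def by (auto elim!: dvdE)
  have Q_const: "of_nat (n * q) = [:int (n * q):]"
    by (simp add: of_nat_poly)
  have linear: "[:1, int (j + i * q):] = [:1, int j:] + Q * (of_nat i * t)" for i j
    by (simp add: Q_def t_def of_nat_poly)
  have "\<exists>z. (\<Prod>j<q. [:1, int (j + i * q):]) = P + Q * (of_nat i * S + Q * z)" for i
  proof -
    obtain z where "(\<Prod>j<q. [:1, int j:] + Q * (of_nat i * t)) = (\<Prod>j<q. [:1, int j:])
        + Q * (\<Sum>j<q. of_nat i * t * (\<Prod>l\<in>{..<q} - {j}. [:1, int l:])) + Q\<^sup>2 * z"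
      using prod_first_order[of "{..<q}" "\<lambda>j. [:1, int j:]" Q "\<lambda>_. of_nat i * t"] by auto
    then have "(\<Prod>j<q. [:1, int (j + i * q):]) = P + Q * (of_nat i * S + Q * z)"
      by (simp only: linear)
        (simp add: P_def rising_prod_def S_def sum_distrib_left algebra_simps power2_eq_square)
    then show ?thesis by blast
  qed
  then obtain z where block:
    "\<And>i. (\<Prod>j<q. [:1, int (j + i * q):]) = P + Q * (of_nat i * S + Q * z i)"
    by metis
  have "rising_prod (n * q) = (\<Prod>i<n. \<Prod>j<q. [:1, int (j + i * q):])"
    unfolding rising_prod_def
  proof (subst prod.nat_group[symmetric], rule prod.cong)
    fix i
    show "(\<Prod>j = i * q..<i * q + q. [:1, int j:]) = (\<Prod>j<q. [:1, int (j + i * q):])"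
      using prod.shift_bounds_nat_ivl[of "\<lambda>j. [:1, int j:]" 0 "i * q" q]
      by (simp add: lessThan_atLeast0 add.commute)
  qed simp
  also have "\<dots> = (\<Prod>i<n. P + Q * (of_nat i * S + Q * z i))"
    by (simp only: block)
  finally have R: "rising_prod (n * q) = (\<Prod>i<n. P + Q * (of_nat i * S + Q * z i))" .
  \<comment> \<open>The second-order term \<open>Q\<^sup>2 z\<^sub>i\<close> of each block is carried along inside its deviation.\<close>
  obtain w where w: "(\<Prod>i<n. P + Q * (of_nat i * S + Q * z i)) = (\<Prod>i<n. P)
      + Q * (\<Sum>i<n. (of_nat i * S + Q * z i) * (\<Prod>l\<in>{..<n} - {i}. P)) + Q\<^sup>2 * w"
    using prod_first_order[of "{..<n}" "\<lambda>_. P" Q "\<lambda>i. of_nat i * S + Q * z i"] by auto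
  have "(\<Sum>i<n. (of_nat i * S + Q * z i) * (\<Prod>l\<in>{..<n} - {i}. P))
      = of_nat (\<Sum>i<n. i) * (S * P ^ (n - 1)) + Q * (\<Sum>i<n. z i * P ^ (n - 1))"
    by (simp add: sum.distrib sum_distrib_left sum_distrib_right algebra_simps)
  then have diff: "rising_prod (n * q) - P ^ n = Q * (of_nat (\<Sum>i<n. i) * (S * P ^ (n - 1))
      + Q * (\<Sum>i<n. z i * P ^ (n - 1)) + Q * w)"
    unfolding R w by (simp add: algebra_simps power2_eq_square)
  have "(of_nat n :: int poly) dvd of_nat (\<Sum>i<n. i)"
    using odd_dvd_sum_lessThan[OF assms(1)] by (metis dvd_def of_nat_mult)
  then have "Q * of_nat n dvd rising_prod (n * q) - P ^ n"
    unfolding diff using nQ by (intro mult_dvd_mono dvd_add dvd_mult2) auto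
  then show ?thesis
    unfolding P_def Q_const[symmetric] by (simp add: Q_def mult.commute)
qed

lemma rising_prod_prime_power:
  assumes "prime p" and "odd p"
  shows "[:int (p ^ Suc s):] dvd rising_prod (p ^ Suc s) - (1 - monom 1 (p - 1)) ^ p ^ s"
proof (induction s)
  case 0
  show ?case using rising_prod_prime[OF assms(1)] by simp
next
  case (Suc s)
  let ?q = "p ^ Suc s" and ?g = "(1 - monom 1 (p - 1)) ^ p ^ s :: int poly"
  have "of_nat p * [:int ?q:] dvd rising_prod ?q ^ p - ?g ^ p"
    by (rule mult_dvd_power_diff[OF Suc.IH]) (simp add: of_nat_poly)
  then have "[:int (p * ?q):] dvd rising_prod ?q ^ p - ?g ^ p"
    by (simp add: of_nat_poly mult_ac)
  moreover have "[:int (p * ?q):] dvd rising_prod (p * ?q) - rising_prod ?q ^ p"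
    using assms(2) by (intro rising_prod_blocks) auto
  ultimately have "[:int (p * ?q):] dvd
      (rising_prod (p * ?q) - rising_prod ?q ^ p) + (rising_prod ?q ^ p - ?g ^ p)"
    by (rule dvd_add[rotated])
  then show ?case
    by (simp add: mult.commute flip: power_mult)
qed

section \<open>Coefficients of the right-hand side\<close>

lemma one_minus_monom_power:
  "(1 - monom 1 d) ^ n = (\<Sum>l\<le>n. monom ((-1) ^ l * int (n choose l)) (d * l))"
proof -
  have "(1 - monom 1 d :: int poly) ^ n = (monom (-1) d + 1) ^ n"
    by (simp add: minus_monom[symmetric])
  also have "\<dots> = (\<Sum>l\<le>n. monom ((-1) ^ l * int (n choose l)) (d * l))"
    by (simp add: binomial_ring monom_power of_nat_monom mult_monom mult.commute)
  finally show ?thesis .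
qed

lemma coeff_one_minus_monom_power_not_dvd:
  "\<not> d dvd m \<Longrightarrow> coeff ((1 - monom 1 d :: int poly) ^ n) m = 0"
  by (auto simp: one_minus_monom_power coeff_sum intro!: sum.neutral)

lemma coeff_one_minus_monom_power_mult:
  assumes "d > 0" and "l \<le> n"
  shows "coeff ((1 - monom 1 d) ^ n) (d * l) = (-1) ^ l * int (n choose l)"
  using assms by (simp add: one_minus_monom_power coeff_sum)

lemma prime_dvd_prime_power_choose:
  fixes p :: nat
  assumes "prime p" and "0 < i" and "i < p ^ s"
  shows "p dvd (p ^ s choose i)"
proof (rule ccontr)
  assume "\<not> p dvd (p ^ s choose i)"
  then have "coprime (p ^ s) (p ^ s choose i)"
    using prime_imp_coprime[OF assms(1)] by simp
  moreover have "p ^ s dvd i * (p ^ s choose i)"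
    using times_binomial_minus1_eq[OF assms(2), of "p ^ s"] by simp
  ultimately have "p ^ s dvd i"
    by (simp add: coprime_dvd_mult_left_iff)
  then show False
    using assms(2,3) by (auto dest: dvd_imp_le)
qed

text \<open>
  By Pascal's rule, consecutive entries of row \<open>p\<^sup>s - 1\<close> sum to an inner entry of row \<open>p\<^sup>s\<close>,
  which is divisible by \<open>p\<close>; so the entries are \<open>\<plusminus>1\<close> modulo \<open>p\<close>.
\<close>

lemma not_prime_dvd_pred_prime_power_choose:
  fixes p :: nat
  assumes "prime p" and "i < p ^ s"
  shows "\<not> p dvd (p ^ s - 1 choose i)"
  using assms(2)
proof (induction i)
  case 0
  then show ?case using assms(1) by auto
next
  case (Suc i)
  have "p ^ s choose Suc i = (p ^ s - 1 choose i) + (p ^ s - 1 choose Suc i)"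
    using Suc.prems by (cases "p ^ s") auto
  then show ?case
    using prime_dvd_prime_power_choose[OF assms(1) _ Suc.prems] Suc
    by (metis Suc_lessD dvd_add_left_iff zero_less_Suc)
qed

text \<open>
  Compare valuations in \<open>l (p\<^sup>s choose l) = p\<^sup>s (p\<^sup>s - 1 choose l - 1)\<close>, where the last factor is
  prime to \<open>p\<close>.
\<close>

lemma multiplicity_prime_power_choose:
  fixes p :: nat
  assumes "prime p" and "0 < l" and "l \<le> p ^ s"
  shows "multiplicity p (p ^ s choose l) + multiplicity p l = s"
proof -
  have "\<not> p dvd (p ^ s - 1 choose (l - 1))"
    using assms by (intro not_prime_dvd_pred_prime_power_choose) auto
  then have "multiplicity p ((p ^ s - 1 choose (l - 1)) * p ^ s) = s"
    using assms(1) by (simp add: multiplicity_prime_elem_times_other)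
  moreover have "(p ^ s - 1 choose (l - 1)) * p ^ s = (p ^ s choose l) * l"
    using times_binomial_minus1_eq[OF assms(2), of "p ^ s"] by (simp add: mult.commute)
  moreover have "p ^ s choose l > 0"
    using assms(3) by simp
  ultimately show ?thesis
    using assms(1,2) by (simp add: prime_elem_multiplicity_mult_distrib)
qed

section \<open>Valuations of the Stirling numbers\<close>

lemma vp_ge_iff_dvd:
  assumes "prime p"
  shows "vp p m \<ge> ereal (real r) \<longleftrightarrow> int (p ^ r) dvd m"
  proof (cases "m = 0")
  case False
  moreover have "\<not> is_unit (int p)"
    using assms by auto
  ultimately show ?thesis
    by (simp add: vp_def power_dvd_iff_le_multiplicity)
qed (simp add: vp_def)

lemma multiplicity_int: "multiplicity (int p) (int n) = multiplicity p n"
  by (simp add: multiplicity_def flip: of_nat_power)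

text \<open>
  Up to the exponent \<open>r\<close>, the same powers of \<open>p\<close> divide \<open>a\<close> and \<open>b\<close>, and the bound on the
  valuation of \<open>b\<close> leaves room for the first power that does not divide.
\<close>

lemma multiplicity_eq_of_dvd_diff:
  fixes a b :: int
  assumes "prime p" and "p ^ r dvd a - b" and "b \<noteq> 0" and "multiplicity p b < r"
  shows "a \<noteq> 0" and "multiplicity p a = multiplicity p b"
proof -
  have iff: "p ^ i dvd a \<longleftrightarrow> p ^ i dvd b" if "i \<le> r" for i
    using that assms(2) by (metis dvd_diff_right_iff dvd_diff_left_iff le_imp_power_dvd dvd_trans)
  have "\<not> is_unit p"
    using assms(1) by auto
  then have "\<not> p ^ Suc (multiplicity p b) dvd b"
    using assms(3) by (simp add: power_dvd_iff_le_multiplicity del: power_Suc)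
  then have "\<not> p ^ Suc (multiplicity p b) dvd a"
    using iff[of "Suc (multiplicity p b)"] assms(4) by simp
  moreover have "p ^ multiplicity p b dvd a"
    using iff[of "multiplicity p b"] assms(4) by (simp add: multiplicity_dvd)
  ultimately show "a \<noteq> 0" and "multiplicity p a = multiplicity p b"
    by (auto intro: multiplicity_eqI)
qed

theorem corollary1p2:
  fixes p r :: nat and k :: int
  assumes "prime p" and "odd p" and "r > 0"
  shows "(\<not> (int p - 1) dvd (int (p ^ r) - k) \<longrightarrow> vp p (stirling1 (p ^ r) k) \<ge> ereal (real r)) \<and>
    (\<forall>l :: int. int (p ^ r) - k = l * (int p - 1) \<and> 1 \<le> l \<and> l \<le> int (p ^ (r - 1))
           \<longrightarrow> vp p (stirling1 (p ^ r) k) = ereal (real r) - 1 - vp p l)"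
proof -
  obtain s where r: "r = Suc s"
    using assms(3) gr0_conv_Suc by blast
  have p: "p > 1"
    using assms(1) by (rule prime_gt_1_nat)
  let ?g = "(1 - monom 1 (p - 1)) ^ p ^ s :: int poly"
  have cong: "int (p ^ r) dvd stirling1 (p ^ r) (int (p ^ r) - int m) - coeff ?g m"
    if "m \<le> p ^ r" for m
    using rising_prod_prime_power[OF assms(1,2), of s] coeff_rising_prod[OF that]
    unfolding const_poly_dvd_iff r by (metis coeff_diff)
  have part1: "vp p (stirling1 (p ^ r) k) \<ge> ereal (real r)"
    if nd: "\<not> (int p - 1) dvd (int (p ^ r) - k)"
  proof (cases "0 \<le> k \<and> k \<le> int (p ^ r)")
    case False
    then have "stirling1 (p ^ r) k = 0"
      using stirling1_neg stirling1_gt by (meson not_le)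
    then show ?thesis by (simp add: vp_def)
  next
    case True
    define m where "m = nat (int (p ^ r) - k)"
    have m: "m \<le> p ^ r" "int m = int (p ^ r) - k"
      using True by (auto simp: m_def nat_le_iff)
    have "\<not> int (p - 1) dvd int m"
      using nd p m(2) by (simp add: of_nat_diff)
    then have "coeff ?g m = 0"
      by (intro coeff_one_minus_monom_power_not_dvd) simp
    then show ?thesis
      using cong[OF m(1)] m(2) by (simp add: vp_ge_iff_dvd[OF assms(1)])
  qed
  have part2: "vp p (stirling1 (p ^ r) k) = ereal (real r) - 1 - vp p l"
    if kl: "int (p ^ r) - k = l * (int p - 1)" and l: "1 \<le> l" "l \<le> int (p ^ (r - 1))" for l
  proof -
    define n where "n = nat l"
    have n: "l = int n" "0 < n" "n \<le> p ^ s"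
      using l by (auto simp: n_def r nat_le_iff)
    have le: "(p - 1) * n \<le> p ^ r"
      unfolding r power_Suc using n(3) by (intro mult_mono) auto
    have k: "int (p ^ r) - int ((p - 1) * n) = k"
      using kl p n(1) by (simp add: of_nat_diff algebra_simps)
    define b where "b = (-1) ^ n * int (p ^ s choose n)"
    have dvd: "int p ^ r dvd stirling1 (p ^ r) k - b"
      using cong[OF le, unfolded k] coeff_one_minus_monom_power_mult[of "p - 1" n "p ^ s"] p n(3)
      by (simp add: b_def)
    have "b \<noteq> 0"
      using n(3) by (simp add: b_def)
    have "multiplicity (int p) b = multiplicity (int p) (int (p ^ s choose n))"
      by (cases "even n") (simp_all add: b_def)
    then have mult_b: "multiplicity (int p) b + multiplicity (int p) l = s"
      using multiplicity_prime_power_choose[OF assms(1) n(2,3)] by (simp add: n(1) multiplicity_int)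
    then have "multiplicity (int p) b < r"
      by (simp add: r)
    from multiplicity_eq_of_dvd_diff[OF _ dvd \<open>b \<noteq> 0\<close> this] assms(1)
    have "vp p (stirling1 (p ^ r) k) = ereal (real (multiplicity (int p) b))"
      by (simp add: vp_def)
    moreover have "real (multiplicity (int p) b) = real r - 1 - real (multiplicity (int p) l)"
      using mult_b by (simp add: r)
    ultimately show ?thesis
      using l(1) by (simp add: vp_def one_ereal_def)
  qed
  show ?thesis
    using part1 part2 by blast
qed

end
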